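(* Let $n\ge 1$, let $\mu$ be a log-concave measure on $\mathbb{R}^n$, and let $f,g:\mathbb{R}^n\to[0,1]$ be measurable functions which have finite integral with respect to $\mu$. For any $\lambda\in(0,1)$, the function $$h_\lambda(z)=\sup_{0<t<1}\ \sup_{z=(1-t)x+ty}\ \min\left\{f(x)^{\frac{1-t}{1-\lambda}},\ g(y)^{\frac{t}{\lambda}}\right\}$$ (where the inner supremum is over all pairs $x,y\in\mathbb{R}^n$ with $z=(1-t)x+ty$) satisfies $$\int_{\mathbb{R}^n}h_\lambda\,d\mu\ \ge\ \left((1-\lambda)\left(\int_{\mathbb{R}^n}f\,d\mu\right)^{-1}+\lambda\left(\int_{\mathbb{R}^n}g\,d\mu\right)^{-1}\right)^{-1}.$$
   Context: A measure $\mu$ on $\mathbb{R}^n$ is log-concave if for every $\theta\in(0,1)$ and all non-empty Borel sets $A,B,C\subseteq\mathbb{R}^n$ with $(1-\theta)A+\theta B\subseteq C$ one has $\mu(C)\ge\mu(A)^{1-\theta}\mu(B)^{\theta}$. If $h_\lambda$ is not measurable, its integral is understood as an upper integral, i.e. the infimum of $\int H\,d\mu$ over all measurable $H\ge h_\lambda$. Inverses are taken in $[0,\infty]$ with the conventions $0^{-1}=\infty$ and $\infty^{-1}=0$. *)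

theory Defs
  imports "HOL-Analysis.Analysis"
begin

text \<open>Powers of elements of \<open>[0, \<infinity>]\<close> with exponent \<open>a > 0\<close>; in particular \<open>0 powr a = 0\<close> and
  \<open>\<infinity> powr a = \<infinity>\<close>. Only positive exponents are used below.\<close>

definition ennreal_powr :: "ennreal \<Rightarrow> real \<Rightarrow> ennreal" where
  "ennreal_powr x a = (if x = \<infinity> then \<infinity> else ennreal (enn2real x powr a))"

text \<open>The product of the two powers is taken in \<open>[0, \<infinity>]\<close> with \<open>0 * \<infinity> = 0\<close>.\<close>

definition log_concave_measure :: "'a::real_normed_vector measure \<Rightarrow> bool" where
  "log_concave_measure \<mu> \<longleftrightarrow> sets \<mu> = sets borel \<and>
     (\<forall>\<theta> A B C. 0 < \<theta> \<and> \<theta> < 1 \<and>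
        A \<in> sets borel \<and> B \<in> sets borel \<and> C \<in> sets borel \<and>
        A \<noteq> {} \<and> B \<noteq> {} \<and> C \<noteq> {} \<and>
        {(1 - \<theta>) *\<^sub>R a + \<theta> *\<^sub>R b | a b. a \<in> A \<and> b \<in> B} \<subseteq> C \<longrightarrow>
        emeasure \<mu> C \<ge> ennreal_powr (emeasure \<mu> A) (1 - \<theta>) * ennreal_powr (emeasure \<mu> B) \<theta>)"

text \<open>On non-measurable functions the library's \<^const>\<open>nn_integral\<close> is a lower integral, hence a
  separate notion.\<close>

definition upper_nn_integral :: "'a measure \<Rightarrow> ('a \<Rightarrow> ennreal) \<Rightarrow> ennreal" where
  "upper_nn_integral M h = (INF H \<in> {H \<in> borel_measurable M. \<forall>x\<in>space M. h x \<le> H x}. \<integral>\<^sup>+x. H x \<partial>M)"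

lemma upper_nn_integral_measurable:
  assumes "h \<in> borel_measurable M"
  shows "upper_nn_integral M h = (\<integral>\<^sup>+x. h x \<partial>M)"
  unfolding upper_nn_integral_def
proof (rule antisym)
  show "(INF H \<in> {H \<in> borel_measurable M. \<forall>x\<in>space M. h x \<le> H x}. \<integral>\<^sup>+x. H x \<partial>M) \<le> (\<integral>\<^sup>+x. h x \<partial>M)"
    by (rule INF_lower) (use assms in auto)
  show "(\<integral>\<^sup>+x. h x \<partial>M) \<le> (INF H \<in> {H \<in> borel_measurable M. \<forall>x\<in>space M. h x \<le> H x}. \<integral>\<^sup>+x. H x \<partial>M)"
    by (rule INF_greatest) (auto intro: nn_integral_mono)
qed

text \<open>The suprema are taken in \<^typ>\<open>ennreal\<close>, a complete lattice; for \<open>f, g\<close> with values in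
  \<open>[0, 1]\<close> they lie in \<open>[0, 1]\<close>, so they agree with the real suprema.\<close>

definition sup_min_fun ::
  "real \<Rightarrow> ('a::real_normed_vector \<Rightarrow> real) \<Rightarrow> ('a \<Rightarrow> real) \<Rightarrow> 'a \<Rightarrow> ennreal" where
  "sup_min_fun l f g z =
     (SUP t \<in> {0<..<1}. SUP (x, y) \<in> {(x, y). z = (1 - t) *\<^sub>R x + t *\<^sub>R y}.
        ennreal (min (f x powr ((1 - t) / (1 - l))) (g y powr (t / l))))"

end

theory Submission
  imports Defs "HOL-Complex_Analysis.Conformal_Mappings" "HOL-Real_Asymp.Real_Asymp"
begin

text \<open>
  On a logarithmic scale of levels the statement becomes an inequality on the half-line. Put
  \<open>a(u) = \<mu> {f \<ge> exp (- u)}\<close> and \<open>b(v) = \<mu> {g \<ge> exp (- v)}\<close>, let \<open>k\<close> be a measurable majorant of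
  the supremum \<open>sup_min_fun l f g\<close>, truncated at \<open>1\<close>, and put \<open>c(p) = \<mu> {k \<ge> exp (- p)}\<close>. The layer
  cake formula reads \<open>\<integral> f d\<mu> = \<integral> exp (- u) a(u) du\<close>, and likewise for \<open>g\<close> and \<open>k\<close>
  (\<open>layer_cake_exp\<close>).

  If \<open>f x \<ge> exp (- u)\<close> and \<open>g y \<ge> exp (- v)\<close>, and if \<open>p\<close> is the weighted harmonic mean
  \<open>1 / p = (1 - l) / u + l / v\<close>, then for \<open>t = p l / v\<close> both powers in the definition of the supremum
  are at least \<open>exp (- p)\<close>. Log-concavity of \<open>\<mu>\<close> with this weight gives
  \<open>c(p) \<ge> a(u) powr (1 - t) * b(v) powr t\<close> (\<open>exp_level_measure_log_concave\<close>).

  It remains to deduce from this, for functions of one real variable, that \<open>\<integral> exp (- p) c(p) dp\<close> is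
  at least the weighted harmonic mean of \<open>F = \<integral> exp (- u) a(u) du\<close> and
  \<open>G = \<integral> exp (- v) b(v) dv\<close>. This is an inequality of Prekopa-Leindler type, in the form found by
  K. Ball, and it is proved by transport. With \<open>A(u) = exp (- u) a(u)\<close> and
  \<open>B(v) = exp (- v) b(v)\<close>, let \<open>u(s)\<close> and \<open>v(s)\<close> be the points to the left of which lies the
  fraction \<open>s\<close> of the mass of \<open>A\<close> and of \<open>B\<close>, so that \<open>u' = F / A(u)\<close> and \<open>v' = G / B(v)\<close>. The
  harmonic mean \<open>p(s)\<close> of \<open>u(s)\<close> and \<open>v(s)\<close> then satisfies
  \<open>exp (- p) c(p) p' \<ge> 1 / ((1 - l) / F + l / G)\<close>, by two applications of the inequality between
  arithmetic and geometric means (\<open>harmonic_transport_speed\<close>), and integrating over \<open>s\<close> in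
  \<open>(0, 1)\<close> gives the claim. The derivatives exist if \<open>a\<close> and \<open>b\<close> are continuous. In general these
  functions are only monotone; they are first averaged over short intervals to the left
  (\<open>continuous_minorant_of_mono\<close>), with a loss that tends to \<open>0\<close> with the length of the interval.
\<close>

section \<open>Layer cake formula on a logarithmic scale\<close>

lemma nn_integral_exp_tail:
  fixes y :: real
  assumes "0 \<le> y"
  shows "(\<integral>\<^sup>+p. ennreal (exp (- p)) * indicator {p. exp (- p) \<le> y} p \<partial>lborel) = ennreal y"
proof (cases "y = 0")
  case True
  then show ?thesis by (simp add: not_le)
next
  case False
  with assms have y: "0 < y" by simp
  have "{p. exp (- p) \<le> y} = {- ln y..}"
    using y by (auto simp: ln_ge_iff minus_le_iff)
  moreover have "((\<lambda>p. - exp (- p)) \<longlongrightarrow> (0::real)) at_top"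
    by real_asymp
  then have "(\<integral>\<^sup>+p. ennreal (exp (- p)) * indicator {- ln y..} p \<partial>lborel)
      = ennreal (0 - (- exp (- (- ln y))))"
    by (intro nn_integral_FTC_atLeast) (auto intro!: derivative_eq_intros)
  ultimately show ?thesis using y by simp
qed

text \<open>The measure \<open>M\<close> is arbitrary, whereas exchanging the two integrals needs a \<open>\<sigma>\<close>-finite one. The
  integrals over \<open>M\<close> are therefore moved to the finite measure with density \<open>f\<close>, at the price of a
  factor \<open>1 / f\<close>, and moved back after the exchange. Nothing is lost where \<open>f\<close> vanishes, because
  such points lie in no level set.\<close>

lemma layer_cake_exp:
  fixes f :: "'a \<Rightarrow> real"
  assumes f[measurable]: "f \<in> borel_measurable M" and nonneg: "\<And>x. 0 \<le> f x"
    and fin: "(\<integral>\<^sup>+x. ennreal (f x) \<partial>M) < \<infinity>"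
  shows "(\<integral>\<^sup>+x. ennreal (f x) \<partial>M)
    = (\<integral>\<^sup>+p. ennreal (exp (- p)) * emeasure M {x \<in> space M. exp (- p) \<le> f x} \<partial>lborel)"
proof -
  define N where "N = density M (\<lambda>x. ennreal (f x))"
  have [measurable_cong]: "sets N = sets M" and [simp]: "space N = space M"
    by (auto simp: N_def)
  interpret N: finite_measure N
    by (rule finite_measureI) (use fin in \<open>simp add: N_def emeasure_density cong: nn_integral_cong\<close>)
  interpret P: pair_sigma_finite N lborel ..
  let ?k = "\<lambda>x p. ennreal (exp (- p)) * indicator {p. exp (- p) \<le> f x} p :: ennreal"
  let ?r = "\<lambda>x. ennreal (1 / f x)"
  have [measurable]: "(\<lambda>(x, p). ?k x p) \<in> borel_measurable (N \<Otimes>\<^sub>M lborel)"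
    by (simp add: indicator_def) measurable
  have cancel: "ennreal (f x) * (?r x * ?k x p) = ?k x p" for x p
  proof (cases "f x = 0")
    case False
    then have "ennreal (f x) * ?r x = 1"
      using nonneg[of x] by (simp flip: ennreal_mult' add: ennreal_1[symmetric] del: ennreal_1)
    then show ?thesis by (metis mult.assoc mult_1)
  qed (simp add: not_le)
  have "(\<integral>\<^sup>+x. ennreal (f x) \<partial>M) = (\<integral>\<^sup>+x. (\<integral>\<^sup>+p. ?k x p \<partial>lborel) \<partial>M)"
    by (simp add: nn_integral_exp_tail nonneg)
  also have "\<dots> = (\<integral>\<^sup>+x. ennreal (f x) * (\<integral>\<^sup>+p. ?r x * ?k x p \<partial>lborel) \<partial>M)"
    by (intro nn_integral_cong, subst nn_integral_cmult[symmetric], measurable) (simp only: cancel)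
  also have "\<dots> = (\<integral>\<^sup>+x. (\<integral>\<^sup>+p. ?r x * ?k x p \<partial>lborel) \<partial>N)"
    unfolding N_def by (subst nn_integral_density) measurable
  also have "\<dots> = (\<integral>\<^sup>+p. (\<integral>\<^sup>+x. ?r x * ?k x p \<partial>N) \<partial>lborel)"
    by (rule P.Fubini'[symmetric]) measurable
  also have "\<dots> = (\<integral>\<^sup>+p. (\<integral>\<^sup>+x. ?k x p \<partial>M) \<partial>lborel)"
    unfolding N_def by (subst nn_integral_density, measurable) (simp only: cancel)
  also have "\<dots> = (\<integral>\<^sup>+p. ennreal (exp (- p)) * emeasure M {x \<in> space M. exp (- p) \<le> f x} \<partial>lborel)"
  proof (intro nn_integral_cong)
    fix p :: real
    have "(\<integral>\<^sup>+x. ?k x p \<partial>M)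
        = (\<integral>\<^sup>+x. ennreal (exp (- p)) * indicator {x \<in> space M. exp (- p) \<le> f x} x \<partial>M)"
      by (intro nn_integral_cong) (simp add: indicator_def)
    then show "(\<integral>\<^sup>+x. ?k x p \<partial>M)
        = ennreal (exp (- p)) * emeasure M {x \<in> space M. exp (- p) \<le> f x}"
      by (simp add: nn_integral_cmult_indicator)
  qed
  finally show ?thesis .
qed

section \<open>Quantile functions of continuous densities\<close>

text \<open>In probabilistic terms \<open>u\<close> is the quantile function of the density \<open>A / F\<close>, and
  \<open>u' = F / A(u)\<close> is the derivative of an inverse function. That the support of \<open>A\<close> is an up-set is
  what makes this a global inverse: the primitive of \<open>A\<close> is strictly increasing on the support, so
  it maps the support bijectively onto \<open>(0, F)\<close>.\<close>

lemma smooth_quantile: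
  fixes A :: "real \<Rightarrow> real"
  assumes cont: "continuous_on UNIV A" and nonneg: "\<And>x. 0 \<le> A x"
    and up: "\<And>x y. x \<le> y \<Longrightarrow> 0 < A x \<Longrightarrow> 0 < A y" and zero: "\<And>x. x \<le> 0 \<Longrightarrow> A x = 0"
    and int: "integrable lborel A" and F: "F = integral\<^sup>L lborel A" "0 < F"
  obtains u where "\<And>s. s \<in> {0<..<1} \<Longrightarrow> 0 < A (u s)"
    and "\<And>s. s \<in> {0<..<1} \<Longrightarrow> (u has_real_derivative F / A (u s)) (at s)"
proof -
  define \<Phi> where "\<Phi> = (\<lambda>x. integral {0..x} A)"
  define S where "S = {x. 0 < A x}"
  have contI: "continuous_on I A" for I
    using cont by (rule continuous_on_subset) simp
  have \<Phi>0: "\<Phi> x = 0" if "x \<le> 0" for x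
    using that by (cases "x = 0") (auto simp: \<Phi>_def)
  have pos: "0 < x" if "x \<in> S" for x
    using that zero[of x] by (force simp: S_def not_le[symmetric])
  have deriv: "(\<Phi> has_real_derivative A x) (at x)" if "0 < x" for x
  proof -
    have "(\<Phi> has_real_derivative A x) (at x within {0..x+1})"
      unfolding \<Phi>_def by (rule integral_has_real_derivative) (use that contI in auto)
    moreover have "x \<in> interior {0..x+1}" using that by simp
    ultimately show ?thesis by (simp only: at_within_interior)
  qed
  have contPhi: "continuous_on I \<Phi>" if "I \<subseteq> {0<..}" for I
    using that deriv by (intro continuous_at_imp_continuous_on) (auto intro: DERIV_isCont)
  have lim: "(\<Phi> \<longlongrightarrow> F) at_top"
  proof -
    have "\<Phi> x = (\<integral>y. indicator {..x} y *\<^sub>R A y \<partial>lborel)" for x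
    proof -
      have "(\<integral>y. indicator {..x} y *\<^sub>R A y \<partial>lborel) = (LINT y:{0..x}|lborel. A y)"
        unfolding set_lebesgue_integral_def
        by (intro Bochner_Integration.integral_cong) (auto simp: indicator_def zero)
      also have "\<dots> = \<Phi> x"
        unfolding \<Phi>_def
      proof (rule set_borel_integral_eq_integral(2))
        show "set_integrable lborel {0..x} A"
          unfolding set_integrable_def using int by (intro integrable_mult_indicator) auto
      qed
      finally show ?thesis ..
    qed
    then have "\<Phi> = (\<lambda>x. \<integral>y. indicator {..x} y *\<^sub>R A y \<partial>lborel)" by (rule ext)
    then show ?thesis unfolding F by (simp only: tendsto_integral_at_top[OF sets_lborel int])
  qed
  have openS: "open S"
    unfolding S_def using cont by (intro open_Collect_less) auto
  have smono: "\<Phi> x < \<Phi> y" if "x \<in> S" "x < y" for x y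
  proof (rule DERIV_pos_imp_increasing[OF that(2)])
    fix z assume "x \<le> z" "z \<le> y"
    then have "0 < A z" "0 < z" using up[of x z] that pos[of x] by (auto simp: S_def)
    then show "\<exists>d. (\<Phi> has_real_derivative d) (at z) \<and> 0 < d" using deriv by blast
  qed
  have inj: "inj_on (\<lambda>x. \<Phi> x / F) S"
    using smono F(2) by (intro linorder_inj_onI') fastforce
  have onto: "\<exists>x\<in>S. \<Phi> x / F = s" if s: "s \<in> {0<..<1}" for s
  proof -
    have "s * F < F" "0 < s * F" using s F by auto
    from order_tendstoD(1)[OF lim this(1)] obtain n where n: "s * F < \<Phi> n"
      by (metis eventually_happens trivial_limit_at_top_linorder)
    then have n0: "0 \<le> n" using \<Phi>0[of n] \<open>0 < s * F\<close> by force
    have "continuous_on {0..n} \<Phi>"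
      unfolding \<Phi>_def by (intro indefinite_integral_continuous_1 integrable_continuous_real contI)
    then obtain x where x: "0 \<le> x" "\<Phi> x = s * F"
      using IVT'[of \<Phi> 0 "s * F" n] n n0 \<Phi>0[of 0] \<open>0 < s * F\<close> by auto
    \<comment> \<open>A point outside the support has only zeros of \<open>A\<close> to its left.\<close>
    have "x \<in> S"
    proof (rule ccontr)
      assume "x \<notin> S"
      then have "A y = 0" if "y \<le> x" for y
        using up[OF that] nonneg[of y] by (force simp: S_def)
      then have "\<Phi> x = integral {0..x} (\<lambda>_. 0)"
        unfolding \<Phi>_def by (intro integral_cong) auto
      then have "\<Phi> x = 0" by simp
      then show False using x \<open>0 < s * F\<close> by linarith
    qed
    moreover have "\<Phi> x / F = s" using x(2) F(2) by simp
    ultimately show ?thesis by blast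
  qed
  define u where "u = the_inv_into S (\<lambda>x. \<Phi> x / F)"
  have uS: "u s \<in> S" "\<Phi> (u s) / F = s" if "s \<in> {0<..<1}" for s
  proof -
    obtain x where x: "x \<in> S" "\<Phi> x / F = s" using onto[OF \<open>s \<in> {0<..<1}\<close>] by blast
    then have "u s = x" unfolding u_def using the_inv_into_f_f[OF inj x(1)] by simp
    then show "u s \<in> S" "\<Phi> (u s) / F = s" using x by auto
  qed
  show thesis
  proof
    fix s :: real assume s: "s \<in> {0<..<1}"
    show A: "0 < A (u s)" using uS[OF s] by (simp add: S_def)
    have "(u has_real_derivative inverse (A (u s) / F)) (at (\<Phi> (u s) / F))"
    proof (rule has_field_derivative_inverse_strong[where S = S and f = "\<lambda>x. \<Phi> x / F" and x = "u s"])
      show "((\<lambda>x. \<Phi> x / F) has_real_derivative A (u s) / F) (at (u s))"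
        using deriv[OF pos[OF uS(1)[OF s]]] by (rule DERIV_cdivide)
      show "continuous_on S (\<lambda>x. \<Phi> x / F)"
        using F pos by (intro continuous_intros contPhi) auto
      show "u (\<Phi> z / F) = z" if "z \<in> S" for z
        unfolding u_def by (rule the_inv_into_f_f[OF inj that])
    qed (use A F uS s openS in auto)
    then show "(u has_real_derivative F / A (u s)) (at s)"
      using uS(2)[OF s] by (simp add: inverse_eq_divide)
  qed
qed

section \<open>A Prekopa-Leindler inequality for harmonic means\<close>

text \<open>These are the weights with which \<open>u\<close> and \<open>v\<close> enter both the exponents and the derivative of
  their weighted harmonic mean.\<close>

lemma harmonic_mean_weights:
  fixes u v l p :: real
  assumes "0 < u" "0 < v" "0 < l" "l < 1" and p: "p = 1 / ((1 - l) / u + l / v)"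
  shows "0 < p" "p * (1 - l) / u + p * l / v = 1"
proof -
  show p0: "0 < p" using assms by (simp add: add_pos_pos)
  have "p * (1 - l) / u + p * l / v = p * ((1 - l) / u + l / v)" by (simp add: algebra_simps)
  also have "\<dots> = 1" using p0 p by (auto simp: zero_less_divide_iff)
  finally show "p * (1 - l) / u + p * l / v = 1" .
qed

lemma weighted_harmonic_le_geometric:
  fixes a b \<alpha> \<beta> :: real
  assumes "0 < a" "0 < b" "0 \<le> \<alpha>" "0 \<le> \<beta>" "\<alpha> + \<beta> = 1"
  shows "1 / (\<alpha> / a + \<beta> / b) \<le> a powr \<alpha> * b powr \<beta>"
proof -
  have "(1 / a) powr \<alpha> * (1 / b) powr \<beta> \<le> \<alpha> * (1 / a) + \<beta> * (1 / b)"
    by (rule Youngs_inequality_0) (use assms in auto)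
  moreover have "0 < \<alpha> / a + \<beta> / b"
    using assms by (cases "\<alpha> = 0") (auto intro!: add_pos_nonneg)
  ultimately have "1 / (\<alpha> / a + \<beta> / b) \<le> 1 / ((1 / a) powr \<alpha> * (1 / b) powr \<beta>)"
    using assms by (intro divide_left_mono mult_pos_pos) auto
  also have "\<dots> = a powr \<alpha> * b powr \<beta>"
    using assms by (simp add: powr_divide)
  finally show ?thesis .
qed

text \<open>The last factor on the right is the derivative \<open>p'\<close> of the harmonic mean \<open>p\<close> of two points that
  move with speeds \<open>F / A\<close> and \<open>G / B\<close>. With the weights \<open>\<alpha>, \<beta>\<close> of \<open>u, v\<close> it is the arithmetic
  mean of \<open>p F / (u A)\<close> and \<open>p G / (v B)\<close>. The geometric mean is smaller, and in it the factors
  \<open>A\<close> and \<open>B\<close> cancel against those in front. What is left is the geometric mean of \<open>p F / u\<close> and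
  \<open>p G / v\<close>, whose harmonic mean no longer depends on \<open>u\<close> and \<open>v\<close>.\<close>

lemma harmonic_transport_speed:
  fixes u v A B F G l p :: real
  assumes "0 < u" "0 < v" "0 < A" "0 < B" "0 < F" "0 < G" "0 < l" "l < 1"
    and p: "p = 1 / ((1 - l) / u + l / v)"
  shows "1 / ((1 - l) / F + l / G)
    \<le> A powr (p * (1 - l) / u) * B powr (p * l / v)
       * (p\<^sup>2 * ((1 - l) * (F / A) / u\<^sup>2 + l * (G / B) / v\<^sup>2))"
proof -
  define \<alpha> \<beta> where "\<alpha> = p * (1 - l) / u" and "\<beta> = p * l / v"
  note weights = harmonic_mean_weights[OF assms(1,2,7,8) p]
  have p0: "0 < p" by (rule weights)
  have ab: "0 < \<alpha>" "0 < \<beta>" using assms p0 by (auto simp: \<alpha>_def \<beta>_def)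
  have sum1: "\<alpha> + \<beta> = 1" unfolding \<alpha>_def \<beta>_def by (rule weights)
  define X Y where "X = p * F / u" and "Y = p * G / v"
  have XY: "0 < X" "0 < Y" using assms p0 by (auto simp: X_def Y_def)
  have "(1 - l) / F + l / G = \<alpha> / X + \<beta> / Y"
    using assms(1-8) p0 by (simp add: X_def Y_def \<alpha>_def \<beta>_def)
  then have "1 / ((1 - l) / F + l / G) \<le> X powr \<alpha> * Y powr \<beta>"
    using weighted_harmonic_le_geometric[of X Y \<alpha> \<beta>] XY ab sum1 by simp
  also have "\<dots> = A powr \<alpha> * B powr \<beta> * ((X / A) powr \<alpha> * (Y / B) powr \<beta>)"
    using assms XY by (simp add: powr_divide)
  also have "\<dots> \<le> A powr \<alpha> * B powr \<beta> * (\<alpha> * (X / A) + \<beta> * (Y / B))"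
    using Youngs_inequality_0[of \<alpha> \<beta> "X / A" "Y / B"] assms XY ab sum1
    by (intro mult_left_mono) auto
  also have "\<alpha> * (X / A) + \<beta> * (Y / B)
      = p\<^sup>2 * ((1 - l) * (F / A) / u\<^sup>2 + l * (G / B) / v\<^sup>2)"
    using assms(1-8) by (simp add: X_def Y_def \<alpha>_def \<beta>_def field_simps power2_eq_square)
  finally show ?thesis by (simp add: \<alpha>_def \<beta>_def)
qed

text \<open>Substitute \<open>p = p(s)\<close>, the weighted harmonic mean of the quantiles \<open>u(s)\<close> and \<open>v(s)\<close> of \<open>A\<close> and
  \<open>B\<close>: the integrand \<open>H(p(s)) p'(s)\<close> is then bounded below by a constant. The parameter \<open>s\<close> stays
  in \<open>[\<epsilon>, 1 - \<epsilon>]\<close>, where \<open>p'\<close> is continuous up to the end points, which costs the factor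
  \<open>1 - 2 \<epsilon>\<close>.\<close>

lemma harmonic_Prekopa_Leindler_continuous:
  fixes A B H :: "real \<Rightarrow> real"
  assumes A: "continuous_on UNIV A" "\<And>x. 0 \<le> A x" "\<And>x y. x \<le> y \<Longrightarrow> 0 < A x \<Longrightarrow> 0 < A y"
      "\<And>x. x \<le> 0 \<Longrightarrow> A x = 0" "integrable lborel A" "0 < integral\<^sup>L lborel A"
    and B: "continuous_on UNIV B" "\<And>x. 0 \<le> B x" "\<And>x y. x \<le> y \<Longrightarrow> 0 < B x \<Longrightarrow> 0 < B y"
      "\<And>x. x \<le> 0 \<Longrightarrow> B x = 0" "integrable lborel B" "0 < integral\<^sup>L lborel B"
    and H: "H \<in> borel_measurable borel"
    and l: "0 < l" "l < 1" and \<epsilon>: "0 < \<epsilon>" "\<epsilon> < 1/2"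
    and ineq: "\<And>u v p. 0 < u \<Longrightarrow> 0 < v \<Longrightarrow> 0 < A u \<Longrightarrow> 0 < B v \<Longrightarrow> p = 1 / ((1 - l) / u + l / v) \<Longrightarrow>
      A u powr (p * (1 - l) / u) * B v powr (p * l / v) \<le> H p"
  shows "ennreal ((1 - 2 * \<epsilon>) * (1 / ((1 - l) / integral\<^sup>L lborel A + l / integral\<^sup>L lborel B)))
    \<le> (\<integral>\<^sup>+p. ennreal (H p) \<partial>lborel)"
proof -
  define F G where "F = integral\<^sup>L lborel A" and "G = integral\<^sup>L lborel B"
  define M where "M = 1 / ((1 - l) / F + l / G)"
  have FG: "0 < F" "0 < G" using A B by (auto simp: F_def G_def)
  obtain u where u: "\<And>s. s \<in> {0<..<1} \<Longrightarrow> 0 < A (u s)"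
    "\<And>s. s \<in> {0<..<1} \<Longrightarrow> (u has_real_derivative F / A (u s)) (at s)"
    by (rule smooth_quantile[of A F]) (use A F_def FG in auto)
  obtain v where v: "\<And>s. s \<in> {0<..<1} \<Longrightarrow> 0 < B (v s)"
    "\<And>s. s \<in> {0<..<1} \<Longrightarrow> (v has_real_derivative G / B (v s)) (at s)"
    by (rule smooth_quantile[of B G]) (use B G_def FG in auto)
  have pos: "0 < u s" "0 < v s" if "s \<in> {0<..<1}" for s
    using u(1)[OF that] v(1)[OF that] A(4)[of "u s"] B(4)[of "v s"] by (force simp: not_le[symmetric])+
  define p where "p = (\<lambda>s. 1 / ((1 - l) / u s + l / v s))"
  define p' where "p' = (\<lambda>s. (p s)\<^sup>2 * ((1 - l) * (F / A (u s)) / (u s)\<^sup>2 + l * (G / B (v s)) / (v s)\<^sup>2))"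
  let ?I = "{\<epsilon>..1 - \<epsilon>}"
  have I: "s \<in> {0<..<1}" if "s \<in> ?I" for s using that \<epsilon> by auto
  have den: "0 < (1 - l) / u s + l / v s" if "s \<in> {0<..<1}" for s
    using pos[OF that] l by (simp add: add_pos_pos)
  have contu: "continuous_on ?I u" "continuous_on ?I v"
    by (blast intro: I DERIV_isCont[OF u(2)] DERIV_isCont[OF v(2)] continuous_at_imp_continuous_on)+
  have contA: "continuous_on ?I (\<lambda>s. A (u s))" "continuous_on ?I (\<lambda>s. B (v s))"
    using continuous_on_compose2[OF A(1) contu(1)] continuous_on_compose2[OF B(1) contu(2)] by auto
  have nz: "u s \<noteq> 0" "v s \<noteq> 0" "A (u s) \<noteq> 0" "B (v s) \<noteq> 0" "(1 - l) / u s + l / v s \<noteq> 0"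
    if "s \<in> ?I" for s
    using pos[OF I[OF that]] u(1)[OF I[OF that]] v(1)[OF I[OF that]] den[OF I[OF that]] by auto
  have contp': "continuous_on ?I p'"
    unfolding p'_def p_def using nz by (intro continuous_intros contu contA) auto
  have p'_nonneg: "0 \<le> p' s" if "s \<in> ?I" for s
    using l FG A(2) B(2) by (simp add: p'_def)
  have derivp: "(p has_real_derivative p' s) (at s)" if "s \<in> ?I" for s
  proof -
    have "(p has_real_derivative
       - ((- ((1 - l) * (F / A (u s))) / (u s)\<^sup>2) + (- (l * (G / B (v s))) / (v s)\<^sup>2))
          / ((1 - l) / u s + l / v s)\<^sup>2) (at s)"
      unfolding p_def using nz[OF that] u(2)[OF I[OF that]] v(2)[OF I[OF that]]
      by (auto intro!: derivative_eq_intros simp: power2_eq_square)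
    moreover have "- ((- ((1 - l) * (F / A (u s))) / (u s)\<^sup>2) + (- (l * (G / B (v s))) / (v s)\<^sup>2))
          / ((1 - l) / u s + l / v s)\<^sup>2 = p' s"
      by (simp add: p'_def p_def power_one_over divide_simps)
    ultimately show ?thesis by simp
  qed
  have key: "M \<le> H (p s) * p' s" if "s \<in> ?I" for s
  proof -
    note s = I[OF that]
    have "M \<le> A (u s) powr (p s * (1 - l) / u s) * B (v s) powr (p s * l / v s) * p' s"
      unfolding M_def p'_def
      by (rule harmonic_transport_speed) (use pos[OF s] u(1)[OF s] v(1)[OF s] FG l in \<open>auto simp: p_def\<close>)
    also have "\<dots> \<le> H (p s) * p' s"
      using pos[OF s] u(1)[OF s] v(1)[OF s] p'_nonneg[OF that]
      by (intro mult_right_mono ineq) (auto simp: p_def)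
    finally show ?thesis .
  qed
  have "ennreal ((1 - 2 * \<epsilon>) * M) = (\<integral>\<^sup>+s. ennreal M * indicator ?I s \<partial>lborel)"
    using \<epsilon> by (simp add: nn_integral_cmult_indicator ennreal_mult'' mult.commute)
  also have "\<dots> \<le> (\<integral>\<^sup>+s. ennreal (H (p s) * p' s * indicator ?I s) \<partial>lborel)"
    by (intro nn_integral_mono) (auto simp: indicator_def intro!: ennreal_leI key)
  also have "\<dots> = (\<integral>\<^sup>+x. ennreal (H x * indicator {p \<epsilon>..p (1 - \<epsilon>)} x) \<partial>lborel)"
    by (rule nn_integral_substitution[symmetric])
       (use derivp contp' p'_nonneg \<epsilon> H in \<open>auto simp: set_borel_measurable_def\<close>)
  also have "\<dots> \<le> (\<integral>\<^sup>+x. ennreal (H x) \<partial>lborel)"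
    by (intro nn_integral_mono) (auto simp: indicator_def)
  finally show ?thesis unfolding M_def F_def G_def .
qed

section \<open>Monotone functions\<close>

text \<open>The minorant is the average of \<open>a\<close> over the window \<open>[x - \<delta>, x]\<close>; as \<open>a\<close> is monotone, it lies
  between the values at the two ends of the window.\<close>

lemma continuous_minorant_of_mono:
  fixes a :: "real \<Rightarrow> real"
  assumes mono: "mono a" and zero: "\<And>x. x < 0 \<Longrightarrow> a x = 0" and \<delta>: "0 < \<delta>"
  obtains b where "continuous_on UNIV b" "mono b"
    "\<And>x. a (x - \<delta>) \<le> b x" "\<And>x. b x \<le> a x" "\<And>x. x \<le> 0 \<Longrightarrow> b x = 0"
proof
  define J where "J = (\<lambda>x. integral {0..x} a)"
  define b where "b = (\<lambda>x. (J x - J (x - \<delta>)) / \<delta>)"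
  have int: "a integrable_on {x..y}" for x y
    using mono by (intro integrable_on_mono_on) (auto simp: mono_on_def dest: monoD)
  have J0: "J x = 0" if "x \<le> 0" for x
    using that by (cases "x = 0") (auto simp: J_def)
  have ab: "integral {x..y} a = J y - J x" if "x \<le> y" for x y
  proof -
    have neg: "integral {x..y} a = 0" if "x \<le> y" "y \<le> 0" for x y
    proof -
      have "integral {x..y} a = integral {x..y} (\<lambda>_. 0)"
        by (rule integral_spike[of "{0}"]) (use that zero in auto)
      then show ?thesis by simp
    qed
    consider "0 \<le> x" | "x \<le> 0" "0 \<le> y" | "y \<le> 0" by linarith
    then show ?thesis
    proof cases
      case 1
      then show ?thesis
        using Henstock_Kurzweil_Integration.integral_combine[OF 1 that int] by (simp add: J_def)
    next
      case 2
      then show ?thesis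
        using Henstock_Kurzweil_Integration.integral_combine[OF 2 int] neg[of x 0] J0[of x]
        by (simp add: J_def)
    next
      case 3
      then show ?thesis using neg[OF that] J0[of x] J0[of y] that by simp
    qed
  qed
  have step: "(y - x) * a x \<le> J y - J x" "J y - J x \<le> (y - x) * a y" if "x \<le> y" for x y
  proof -
    have "integral {x..y} (\<lambda>_. a x) \<le> integral {x..y} a" "integral {x..y} a \<le> integral {x..y} (\<lambda>_. a y)"
      by (intro integral_le int; use monoD[OF mono] in auto)+
    then show "(y - x) * a x \<le> J y - J x" "J y - J x \<le> (y - x) * a y"
      using ab[OF that] that by auto
  qed
  have "isCont J x" for x
  proof -
    have "continuous_on {x-1..x+1} (\<lambda>y. integral {x-1..y} a)"
      by (rule indefinite_integral_continuous_1[OF int])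
    then have "continuous_on {x-1..x+1} (\<lambda>y. J (x-1) + integral {x-1..y} a)"
      by (intro continuous_intros)
    then have "continuous_on {x-1..x+1} J"
      by (rule continuous_on_eq) (auto simp: ab)
    then show ?thesis by (rule continuous_on_interior) simp
  qed
  then have contJ: "continuous_on UNIV J" by (simp add: continuous_at_imp_continuous_on)
  then have "continuous_on UNIV (\<lambda>x. J (x - \<delta>))"
    by (rule continuous_on_compose2) (auto intro: continuous_intros)
  then show "continuous_on UNIV b"
    unfolding b_def using contJ \<delta> by (intro continuous_on_divide continuous_on_diff continuous_on_const) auto
  have window: "\<delta> * a (x - \<delta>) \<le> J x - J (x - \<delta>)" "J x - J (x - \<delta>) \<le> \<delta> * a x" for x
    using step[of "x - \<delta>" x] \<delta> by auto
  show "a (x - \<delta>) \<le> b x" "b x \<le> a x" for x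
    using window[of x] \<delta> by (auto simp: b_def field_simps)
  show "b x = 0" if "x \<le> 0" for x using that \<delta> by (simp add: b_def J0)
  show "mono b"
  proof
    fix x y :: real assume "x \<le> y"
    \<comment> \<open>Disjoint windows are compared as a whole, overlapping ones after removing the common part.\<close>
    have "J x - J (x - \<delta>) \<le> J y - J (y - \<delta>)"
    proof (cases "x \<le> y - \<delta>")
      case True
      then have "\<delta> * a x \<le> \<delta> * a (y - \<delta>)" using mono \<delta> by (simp add: monoD)
      then show ?thesis using window(2)[of x] window(1)[of y] by linarith
    next
      case False
      then have "(y - x) * a (y - \<delta>) \<le> (y - x) * a x"
        using mono \<open>x \<le> y\<close> by (intro mult_left_mono) (auto simp: monoD)
      then show ?thesis using step[of "x - \<delta>" "y - \<delta>"] step[of x y] \<open>x \<le> y\<close> by simp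
    qed
    then show "b x \<le> b y" using \<delta> by (simp add: b_def divide_right_mono)
  qed
qed

text \<open>The minorant dominates the translate of \<open>a\<close> by \<open>\<delta>\<close>, and a translation by \<open>\<delta>\<close> multiplies the
  integral against \<open>exp (- x)\<close> by \<open>exp (- \<delta>)\<close>.\<close>

lemma exp_weighted_continuous_minorant:
  fixes a :: "real \<Rightarrow> real" and F :: real
  assumes mono: "mono a" and nonneg: "\<And>x. 0 \<le> a x" and zero: "\<And>x. x < 0 \<Longrightarrow> a x = 0"
    and \<delta>: "0 < \<delta>" and F: "(\<integral>\<^sup>+x. ennreal (exp (- x) * a x) \<partial>lborel) = ennreal F" "0 < F"
  obtains b where "continuous_on UNIV b" "mono b" "\<And>x. 0 \<le> b x" "\<And>x. b x \<le> a x"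
    "\<And>x. x \<le> 0 \<Longrightarrow> b x = 0" "integrable lborel (\<lambda>x. exp (- x) * b x)"
    "exp (- \<delta>) * F \<le> (\<integral>x. exp (- x) * b x \<partial>lborel)"
proof -
  obtain b where b: "continuous_on UNIV b" "mono b"
    "\<And>x. a (x - \<delta>) \<le> b x" "\<And>x. b x \<le> a x" "\<And>x. x \<le> 0 \<Longrightarrow> b x = 0"
    using continuous_minorant_of_mono[OF mono zero \<delta>] by blast
  have b0: "0 \<le> b x" for x using nonneg[of "x - \<delta>"] b(3)[of x] by linarith
  have [measurable]: "a \<in> borel_measurable borel" "b \<in> borel_measurable borel"
    using mono b(2) by (auto intro: borel_measurable_mono)
  have "(\<integral>\<^sup>+x. ennreal (exp (- x) * b x) \<partial>lborel) \<le> (\<integral>\<^sup>+x. ennreal (exp (- x) * a x) \<partial>lborel)"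
    by (intro nn_integral_mono ennreal_leI mult_left_mono b) simp
  then have fin: "(\<integral>\<^sup>+x. ennreal (exp (- x) * b x) \<partial>lborel) < \<infinity>"
    unfolding F by (rule order.strict_trans1) simp
  have int: "integrable lborel (\<lambda>x. exp (- x) * b x)"
    by (rule integrableI_nonneg) (use b0 fin in auto)
  have "ennreal (exp (- \<delta>) * F) = ennreal (exp (- \<delta>)) * (\<integral>\<^sup>+x. ennreal (exp (- x) * a x) \<partial>lborel)"
    unfolding F by (simp add: ennreal_mult')
  also have "\<dots> = (\<integral>\<^sup>+x. ennreal (exp (- \<delta>)) * ennreal (exp (- x) * a x) \<partial>lborel)"
    by (rule nn_integral_cmult[symmetric]) measurable
  also have "\<dots> = (\<integral>\<^sup>+x. ennreal (exp (- \<delta>)) * ennreal (exp (- (x - \<delta>)) * a (x - \<delta>)) \<partial>lborel)"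
    by (subst nn_integral_real_affine[where c = 1 and t = "- \<delta>"]) (auto simp: algebra_simps)
  also have "\<dots> = (\<integral>\<^sup>+x. ennreal (exp (- x) * a (x - \<delta>)) \<partial>lborel)"
    by (simp flip: ennreal_mult' mult.assoc exp_add)
  also have "\<dots> \<le> (\<integral>\<^sup>+x. ennreal (exp (- x) * b x) \<partial>lborel)"
    by (intro nn_integral_mono ennreal_leI mult_left_mono b) simp
  also have "\<dots> = ennreal (\<integral>x. exp (- x) * b x \<partial>lborel)"
    by (rule nn_integral_eq_integral[OF int]) (use b0 in auto)
  finally have "exp (- \<delta>) * F \<le> (\<integral>x. exp (- x) * b x \<partial>lborel)"
    using b0 by (subst (asm) ennreal_le_iff) auto
  then show thesis using that[of b] b b0 int by blast
qed

lemma weighted_harmonic_mean_mono: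
  fixes F F' G G' l :: real
  assumes "0 < F" "0 < G" "F \<le> F'" "G \<le> G'" "0 < l" "l < 1"
  shows "1 / ((1 - l) / F + l / G) \<le> 1 / ((1 - l) / F' + l / G')"
proof -
  have "(1 - l) / F' + l / G' \<le> (1 - l) / F + l / G"
    using assms by (intro add_mono divide_left_mono mult_pos_pos) auto
  moreover have "0 < (1 - l) / F' + l / G'"
    using assms by (intro add_pos_pos divide_pos_pos) auto
  ultimately show ?thesis by (simp add: frac_le)
qed

text \<open>Continuous minorants of \<open>a\<close> and \<open>b\<close> inherit the hypothesis, so the continuous case applies to
  them with \<open>\<epsilon> = \<delta>\<close>; then \<open>\<delta>\<close> tends to \<open>0\<close>. The weights \<open>exp (- u)\<close>, \<open>exp (- v)\<close> and
  \<open>exp (- p)\<close> fit the hypothesis of the continuous case with equality, because the exponents of the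
  first two are \<open>p (1 - l) / u\<close> and \<open>p l / v\<close>.\<close>

lemma harmonic_Prekopa_Leindler_mono:
  fixes a b c :: "real \<Rightarrow> real" and F G l :: real
  assumes a: "mono a" "\<And>x. 0 \<le> a x" "\<And>x. x < 0 \<Longrightarrow> a x = 0"
    and b: "mono b" "\<And>x. 0 \<le> b x" "\<And>x. x < 0 \<Longrightarrow> b x = 0"
    and c: "mono c"
    and F: "(\<integral>\<^sup>+x. ennreal (exp (- x) * a x) \<partial>lborel) = ennreal F" "0 < F"
    and G: "(\<integral>\<^sup>+x. ennreal (exp (- x) * b x) \<partial>lborel) = ennreal G" "0 < G"
    and l: "0 < l" "l < 1"
    and ineq: "\<And>u v p. 0 < u \<Longrightarrow> 0 < v \<Longrightarrow> 0 < a u \<Longrightarrow> 0 < b v \<Longrightarrow> p = 1 / ((1 - l) / u + l / v) \<Longrightarrow>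
      a u powr (p * (1 - l) / u) * b v powr (p * l / v) \<le> c p"
  shows "ennreal (1 / ((1 - l) / F + l / G)) \<le> (\<integral>\<^sup>+p. ennreal (exp (- p) * c p) \<partial>lborel)"
proof -
  define M where "M = 1 / ((1 - l) / F + l / G)"
  have approx: "ennreal ((1 - 2 * \<delta>) * (exp (- \<delta>) * M)) \<le> (\<integral>\<^sup>+p. ennreal (exp (- p) * c p) \<partial>lborel)"
    if \<delta>: "0 < \<delta>" "\<delta> < 1 / 2" for \<delta> :: real
  proof -
    obtain a' where a': "continuous_on UNIV a'" "mono a'" "\<And>x. 0 \<le> a' x" "\<And>x. a' x \<le> a x"
      "\<And>x. x \<le> 0 \<Longrightarrow> a' x = 0" "integrable lborel (\<lambda>x. exp (- x) * a' x)"
      "exp (- \<delta>) * F \<le> (\<integral>x. exp (- x) * a' x \<partial>lborel)"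
      using exp_weighted_continuous_minorant[OF a \<delta>(1) F] by blast
    obtain b' where b': "continuous_on UNIV b'" "mono b'" "\<And>x. 0 \<le> b' x" "\<And>x. b' x \<le> b x"
      "\<And>x. x \<le> 0 \<Longrightarrow> b' x = 0" "integrable lborel (\<lambda>x. exp (- x) * b' x)"
      "exp (- \<delta>) * G \<le> (\<integral>x. exp (- x) * b' x \<partial>lborel)"
      using exp_weighted_continuous_minorant[OF b \<delta>(1) G] by blast
    let ?A = "\<lambda>x. exp (- x) * a' x" and ?B = "\<lambda>x. exp (- x) * b' x"
    have FG': "0 < exp (- \<delta>) * F" "0 < exp (- \<delta>) * G" using F G by auto
    note FG'' = less_le_trans[OF FG'(1) a'(7)] less_le_trans[OF FG'(2) b'(7)]
    have "1 / ((1 - l) / (exp (- \<delta>) * F) + l / (exp (- \<delta>) * G))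
        \<le> 1 / ((1 - l) / integral\<^sup>L lborel ?A + l / integral\<^sup>L lborel ?B)"
      using FG' a'(7) b'(7) l by (rule weighted_harmonic_mean_mono)
    moreover have "1 / ((1 - l) / (exp (- \<delta>) * F) + l / (exp (- \<delta>) * G)) = exp (- \<delta>) * M"
    proof -
      have "(1 - l) / (exp (- \<delta>) * F) + l / (exp (- \<delta>) * G) = ((1 - l) / F + l / G) / exp (- \<delta>)"
        by (simp add: add_divide_distrib mult.commute)
      then show ?thesis by (simp add: M_def)
    qed
    ultimately have "(1 - 2 * \<delta>) * (exp (- \<delta>) * M)
        \<le> (1 - 2 * \<delta>) * (1 / ((1 - l) / integral\<^sup>L lborel ?A + l / integral\<^sup>L lborel ?B))"
      using \<delta> by (intro mult_left_mono) auto
    then have "ennreal ((1 - 2 * \<delta>) * (exp (- \<delta>) * M))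
        \<le> ennreal ((1 - 2 * \<delta>) * (1 / ((1 - l) / integral\<^sup>L lborel ?A + l / integral\<^sup>L lborel ?B)))"
      by (rule ennreal_leI)
    also have "\<dots> \<le> (\<integral>\<^sup>+p. ennreal (exp (- p) * c p) \<partial>lborel)"
    proof (rule harmonic_Prekopa_Leindler_continuous)
      show "(\<lambda>p. exp (- p) * c p) \<in> borel_measurable borel"
        using borel_measurable_mono[OF c] by measurable
      show "0 < ?A y" if "x \<le> y" "0 < ?A x" for x y
        using monoD[OF a'(2) that(1)] that(2) by (simp add: zero_less_mult_iff)
      show "0 < ?B y" if "x \<le> y" "0 < ?B x" for x y
        using monoD[OF b'(2) that(1)] that(2) by (simp add: zero_less_mult_iff)
      fix u v p :: real
      assume uv: "0 < u" "0 < v" and AB: "0 < ?A u" "0 < ?B v" and p: "p = 1 / ((1 - l) / u + l / v)"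
      have ab': "0 < a' u" "0 < b' v" using AB by (auto simp: zero_less_mult_iff)
      have ab: "0 < a u" "0 < b v" using ab' a'(4)[of u] b'(4)[of v] by auto
      have p0: "0 < p" using harmonic_mean_weights(1)[OF uv l p] .
      have expo: "exp (- u) powr (p * (1 - l) / u) * exp (- v) powr (p * l / v) = exp (- p)"
        using uv by (simp add: exp_powr_real flip: exp_add) (simp add: algebra_simps)
      have "?A u powr (p * (1 - l) / u) * ?B v powr (p * l / v)
          = exp (- p) * (a' u powr (p * (1 - l) / u) * b' v powr (p * l / v))"
        unfolding expo[symmetric] using ab' by (simp add: powr_mult)
      also have "\<dots> \<le> exp (- p) * (a u powr (p * (1 - l) / u) * b v powr (p * l / v))"
        using uv l p0 a' b' by (intro mult_left_mono mult_mono powr_mono2) auto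
      also have "\<dots> \<le> exp (- p) * c p"
        by (intro mult_left_mono ineq uv ab p) simp
      finally show "?A u powr (p * (1 - l) / u) * ?B v powr (p * l / v) \<le> exp (- p) * c p" .
    qed (use a' b' l \<delta> FG'' in \<open>auto intro!: continuous_intros\<close>)
    finally show ?thesis .
  qed
  have "((\<lambda>\<delta>::real. ennreal ((1 - 2 * \<delta>) * (exp (- \<delta>) * M))) \<longlongrightarrow> ennreal ((1 - 2 * 0) * (exp (- 0) * M))) (at_right 0)"
    by (intro tendsto_intros)
  moreover have "\<forall>\<^sub>F \<delta> in at_right (0::real). ennreal ((1 - 2 * \<delta>) * (exp (- \<delta>) * M))
      \<le> (\<integral>\<^sup>+p. ennreal (exp (- p) * c p) \<partial>lborel)"
    using approx by (auto simp: eventually_at_right_field intro!: exI[of _ "1/2"])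
  ultimately have "ennreal ((1 - 2 * 0) * (exp (- 0) * M)) \<le> (\<integral>\<^sup>+p. ennreal (exp (- p) * c p) \<partial>lborel)"
    by (rule tendsto_upperbound) simp
  then show ?thesis by (simp add: M_def)
qed

section \<open>Level sets\<close>

lemma emeasure_superlevel_finite:
  fixes f :: "'a \<Rightarrow> real"
  assumes [measurable]: "f \<in> borel_measurable M" and fin: "(\<integral>\<^sup>+x. ennreal (f x) \<partial>M) < \<infinity>" and r: "0 < r"
  shows "emeasure M {x \<in> space M. r \<le> f x} < \<infinity>"
proof -
  have "emeasure M {x \<in> space M. r \<le> f x} = emeasure M {x \<in> space M. 1 \<le> ennreal (1 / r) * ennreal (f x)}"
    using r by (intro arg_cong[where f = "emeasure M"])
      (auto simp: ennreal_mult'[symmetric] ennreal_1[symmetric] ennreal_le_iff2 simp del: ennreal_1)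
  also have "\<dots> \<le> ennreal (1 / r) * (\<integral>\<^sup>+x. ennreal (f x) * indicator (space M) x \<partial>M)"
    using nn_integral_Markov_inequality[where M = M and u = "\<lambda>x. ennreal (f x)" and A = "space M" and c = "ennreal (1 / r)"] by simp
  also have "\<dots> = ennreal (1 / r) * (\<integral>\<^sup>+x. ennreal (f x) \<partial>M)"
    by (simp cong: nn_integral_cong)
  also have "\<dots> < \<infinity>" using fin by (simp add: ennreal_mult_less_top)
  finally show ?thesis .
qed

definition exp_level_measure :: "'a measure \<Rightarrow> ('a \<Rightarrow> real) \<Rightarrow> real \<Rightarrow> real" where
  "exp_level_measure M f p = measure M {x \<in> space M. exp (- p) \<le> f x}"

lemma exp_level_measure_nonneg: "0 \<le> exp_level_measure M f p"
  by (simp add: exp_level_measure_def)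

lemma exp_level_measure_negative:
  assumes "\<And>x. f x \<le> 1" "p < 0"
  shows "exp_level_measure M f p = 0"
proof -
  have "{x \<in> space M. exp (- p) \<le> f x} = {}"
    using assms by (force simp: not_le intro: le_less_trans)
  then show ?thesis by (simp only: exp_level_measure_def measure_empty)
qed

lemma emeasure_exp_level:
  assumes f: "f \<in> borel_measurable M" and fin: "(\<integral>\<^sup>+x. ennreal (f x) \<partial>M) < \<infinity>"
  shows "emeasure M {x \<in> space M. exp (- p) \<le> f x} = ennreal (exp_level_measure M f p)"
  unfolding exp_level_measure_def using emeasure_superlevel_finite[OF f fin, of "exp (- p)"]
  by (intro emeasure_eq_ennreal_measure) auto

lemma mono_exp_level_measure:
  assumes f[measurable]: "f \<in> borel_measurable M" and fin: "(\<integral>\<^sup>+x. ennreal (f x) \<partial>M) < \<infinity>"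
  shows "mono (exp_level_measure M f)"
proof
  fix p q :: real assume "p \<le> q"
  then have "emeasure M {x \<in> space M. exp (- p) \<le> f x} \<le> emeasure M {x \<in> space M. exp (- q) \<le> f x}"
    by (intro emeasure_mono) (auto intro: order_trans[rotated])
  then show "exp_level_measure M f p \<le> exp_level_measure M f q"
    by (simp add: emeasure_exp_level[OF f fin] exp_level_measure_nonneg)
qed

lemma nn_integral_exp_level_measure:
  assumes f: "f \<in> borel_measurable M" and nonneg: "\<And>x. 0 \<le> f x"
    and fin: "(\<integral>\<^sup>+x. ennreal (f x) \<partial>M) < \<infinity>"
  shows "(\<integral>\<^sup>+p. ennreal (exp (- p) * exp_level_measure M f p) \<partial>lborel) = (\<integral>\<^sup>+x. ennreal (f x) \<partial>M)"
  by (simp add: layer_cake_exp[OF f nonneg fin] emeasure_exp_level[OF f fin] ennreal_mult')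

section \<open>Log-concave measures\<close>

text \<open>The weight \<open>t = p l / v\<close> is chosen so that both powers in the minimum turn the levels
  \<open>exp (- u)\<close> and \<open>exp (- v)\<close> into the same level \<open>exp (- p)\<close>: this forces
  \<open>u (1 - t) / (1 - l) = p = v t / l\<close>, which is solvable exactly when \<open>p\<close> is the weighted harmonic
  mean of \<open>u\<close> and \<open>v\<close>.\<close>

lemma sup_min_fun_lower:
  fixes f g :: "'a::real_normed_vector \<Rightarrow> real" and u v l p :: real
  assumes uv: "0 < u" "0 < v" and l: "0 < l" "l < 1" and p: "p = 1 / ((1 - l) / u + l / v)"
    and x: "exp (- u) \<le> f x" and y: "exp (- v) \<le> g y"
  shows "ennreal (exp (- p)) \<le> sup_min_fun l f g ((1 - p * l / v) *\<^sub>R x + (p * l / v) *\<^sub>R y)"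
proof -
  define t where "t = p * l / v"
  note weights = harmonic_mean_weights[OF uv l p]
  have p0: "0 < p" by (rule weights)
  have t1: "1 - t = p * (1 - l) / u" using weights(2) by (simp add: t_def)
  have "0 < 1 - t" unfolding t1 using uv l p0 by simp
  then have t: "t \<in> {0<..<1}" using uv l p0 by (simp add: t_def)
  have "exp (- p) = exp (- u) powr ((1 - t) / (1 - l))"
    unfolding t1 using uv l by (simp add: exp_powr_real)
  also have "\<dots> \<le> f x powr ((1 - t) / (1 - l))"
    using t l x by (intro powr_mono2) auto
  finally have fx: "exp (- p) \<le> f x powr ((1 - t) / (1 - l))" .
  have "exp (- p) = exp (- v) powr (t / l)"
    unfolding t_def using uv l by (simp add: exp_powr_real)
  also have "\<dots> \<le> g y powr (t / l)"
    using t l y by (intro powr_mono2) auto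
  finally have gy: "exp (- p) \<le> g y powr (t / l)" .
  let ?z = "(1 - t) *\<^sub>R x + t *\<^sub>R y"
  have "ennreal (exp (- p)) \<le> ennreal (min (f x powr ((1 - t) / (1 - l))) (g y powr (t / l)))"
    using fx gy by (intro ennreal_leI) simp
  also have "\<dots> \<le> sup_min_fun l f g ?z"
    unfolding sup_min_fun_def
    by (rule SUP_upper2[OF t], rule SUP_upper2[of "(x, y)"]) auto
  finally show ?thesis by (simp add: t_def)
qed

lemma sup_min_fun_le_1:
  assumes "\<And>x. 0 \<le> f x \<and> f x \<le> 1" "0 < l" "l < 1"
  shows "sup_min_fun l f g z \<le> 1"
  unfolding sup_min_fun_def
proof (intro SUP_least, clarify)
  fix t x y assume "t \<in> {0<..<1::real}"
  then have "f x powr ((1 - t) / (1 - l)) \<le> 1"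
    using assms by (intro powr_le1) auto
  then show "ennreal (min (f x powr ((1 - t) / (1 - l))) (g y powr (t / l))) \<le> 1"
    by (auto simp: ennreal_le_1)
qed

text \<open>By the previous lemma the convex combination of the level sets of \<open>f\<close> and \<open>g\<close> with weight
  \<open>t = p l / v\<close> lies in the level set of \<open>k\<close>, so this is log-concavity for that weight. The level
  sets of \<open>f\<close> and \<open>g\<close> are non-empty as their measures are positive.\<close>

lemma exp_level_measure_log_concave:
  fixes \<mu> :: "'a::real_normed_vector measure"
  assumes \<mu>: "log_concave_measure \<mu>"
    and f: "f \<in> borel_measurable \<mu>" "(\<integral>\<^sup>+x. ennreal (f x) \<partial>\<mu>) < \<infinity>"
    and g: "g \<in> borel_measurable \<mu>" "(\<integral>\<^sup>+x. ennreal (g x) \<partial>\<mu>) < \<infinity>"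
    and k: "k \<in> borel_measurable \<mu>" "\<And>x. 0 \<le> k x" "(\<integral>\<^sup>+x. ennreal (k x) \<partial>\<mu>) < \<infinity>"
    and above: "\<And>z. sup_min_fun l f g z \<le> ennreal (k z)"
    and l: "0 < l" "l < 1" and uv: "0 < u" "0 < v"
    and pos: "0 < exp_level_measure \<mu> f u" "0 < exp_level_measure \<mu> g v"
    and p: "p = 1 / ((1 - l) / u + l / v)"
  shows "exp_level_measure \<mu> f u powr (p * (1 - l) / u) * exp_level_measure \<mu> g v powr (p * l / v)
    \<le> exp_level_measure \<mu> k p"
proof -
  have sets: "sets \<mu> = sets borel" using \<mu> by (simp add: log_concave_measure_def)
  have space: "space \<mu> = UNIV" using sets_eq_imp_space_eq[OF sets] by simp
  define t where "t = p * l / v"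
  note weights = harmonic_mean_weights[OF uv l p]
  have p0: "0 < p" by (rule weights)
  have t1: "1 - t = p * (1 - l) / u" using weights(2) by (simp add: t_def)
  have "0 < 1 - t" unfolding t1 using uv l p0 by simp
  then have t: "0 < t" "t < 1" using uv l p0 by (simp_all add: t_def)
  let ?L = "\<lambda>h q. {x \<in> space \<mu>. exp (- q) \<le> h x}"
  have meas: "?L h q \<in> sets borel" if "h \<in> borel_measurable \<mu>" for h and q :: real
    using that unfolding sets[symmetric] by measurable
  have ne: "?L f u \<noteq> {}" "?L g v \<noteq> {}"
    using pos unfolding exp_level_measure_def by (metis less_irrefl measure_empty)+
  have sub: "{(1 - t) *\<^sub>R x + t *\<^sub>R y | x y. x \<in> ?L f u \<and> y \<in> ?L g v} \<subseteq> ?L k p"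
  proof clarify
    fix x y assume "exp (- u) \<le> f x" "exp (- v) \<le> g y"
    from sup_min_fun_lower[of u v l p f x g y, OF uv l p this]
    have "ennreal (exp (- p)) \<le> ennreal (k ((1 - t) *\<^sub>R x + t *\<^sub>R y))"
      unfolding t_def using above by (rule order_trans)
    then show "(1 - t) *\<^sub>R x + t *\<^sub>R y \<in> space \<mu> \<and> exp (- p) \<le> k ((1 - t) *\<^sub>R x + t *\<^sub>R y)"
      using k(2) by (simp add: space)
  qed
  have "?L k p \<noteq> {}" using sub ne by blast
  then have "ennreal_powr (emeasure \<mu> (?L f u)) (1 - t) * ennreal_powr (emeasure \<mu> (?L g v)) t
      \<le> emeasure \<mu> (?L k p)"
    using \<mu>[unfolded log_concave_measure_def, THEN conjunct2, rule_format,
        of t "?L f u" "?L g v" "?L k p"]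
      t ne sub meas[OF f(1)] meas[OF g(1)] meas[OF k(1)] by simp
  then have "ennreal (exp_level_measure \<mu> f u powr (1 - t) * exp_level_measure \<mu> g v powr t)
      \<le> ennreal (exp_level_measure \<mu> k p)"
    unfolding emeasure_exp_level[OF f] emeasure_exp_level[OF g] emeasure_exp_level[OF k(1,3)]
    by (simp add: ennreal_powr_def exp_level_measure_nonneg ennreal_mult')
  then show ?thesis unfolding t1 unfolding t_def
    by (subst (asm) ennreal_le_iff) (auto simp: exp_level_measure_nonneg)
qed

theorem theorem1p2:
  fixes \<mu> :: "(real ^ 'n) measure"
    and f g :: "real ^ 'n \<Rightarrow> real"
    and l :: real
  assumes "log_concave_measure \<mu>"
    and "f \<in> borel_measurable \<mu>" and "g \<in> borel_measurable \<mu>"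
    and "\<And>x. 0 \<le> f x \<and> f x \<le> 1" and "\<And>x. 0 \<le> g x \<and> g x \<le> 1"
    and "(\<integral>\<^sup>+x. ennreal (f x) \<partial>\<mu>) < \<infinity>" and "(\<integral>\<^sup>+x. ennreal (g x) \<partial>\<mu>) < \<infinity>"
    and "0 < l" and "l < 1"
  shows "upper_nn_integral \<mu> (sup_min_fun l f g) \<ge>
     inverse (ennreal (1 - l) * inverse (\<integral>\<^sup>+x. ennreal (f x) \<partial>\<mu>) +
              ennreal l * inverse (\<integral>\<^sup>+x. ennreal (g x) \<partial>\<mu>))"
proof -
  note f = assms(2) conjunct1[OF assms(4)] assms(6)
  note g = assms(3) conjunct1[OF assms(5)] assms(7)
  note l = assms(8,9)
  have space: "space \<mu> = UNIV"
    using assms(1) sets_eq_imp_space_eq[of \<mu> borel] by (simp add: log_concave_measure_def)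
  obtain F where F: "(\<integral>\<^sup>+x. ennreal (f x) \<partial>\<mu>) = ennreal F" "0 \<le> F"
    using f(3) by (auto simp: less_top_ennreal)
  obtain G where G: "(\<integral>\<^sup>+x. ennreal (g x) \<partial>\<mu>) = ennreal G" "0 \<le> G"
    using g(3) by (auto simp: less_top_ennreal)
  show ?thesis
  proof (cases "F = 0 \<or> G = 0")
    case True
    have "ennreal (1 - l) \<noteq> 0" "ennreal l \<noteq> 0" using l by auto
    with True show ?thesis unfolding F G by (auto simp: ennreal_mult_top)
  next
    case False
    then have FG: "0 < F" "0 < G" using F G by auto
    have rhs: "inverse (ennreal (1 - l) * inverse (ennreal F) + ennreal l * inverse (ennreal G))
        = ennreal (1 / ((1 - l) / F + l / G))"
    proof -
      have "ennreal (1 - l) * inverse (ennreal F) + ennreal l * inverse (ennreal G)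
          = ennreal ((1 - l) / F + l / G)"
        using FG l by (simp add: inverse_ennreal ennreal_mult' ennreal_plus divide_inverse)
      moreover have "0 < (1 - l) / F + l / G" using FG l by (simp add: add_pos_pos)
      ultimately show ?thesis by (simp add: inverse_ennreal inverse_eq_divide)
    qed
    show ?thesis
      unfolding upper_nn_integral_def F G rhs
    proof (rule INF_greatest, clarify)
      fix H assume [measurable]: "H \<in> borel_measurable \<mu>"
        and above: "\<forall>x\<in>space \<mu>. sup_min_fun l f g x \<le> H x"
      \<comment> \<open>Since the supremum is at most \<open>1\<close>, truncating a majorant at \<open>1\<close> keeps it a majorant and makes
        it real-valued.\<close>
      define k where "k = (\<lambda>x. enn2real (min (H x) 1))"
      have k: "ennreal (k x) = min (H x) 1" for x
        unfolding k_def by (intro ennreal_enn2real) (simp add: min_less_iff_disj)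
      show "ennreal (1 / ((1 - l) / F + l / G)) \<le> integral\<^sup>N \<mu> H"
      proof (cases "integral\<^sup>N \<mu> H < \<infinity>")
        case True
        have k_le: "(\<integral>\<^sup>+x. ennreal (k x) \<partial>\<mu>) \<le> integral\<^sup>N \<mu> H"
          by (intro nn_integral_mono) (simp add: k)
        have k': "k \<in> borel_measurable \<mu>" "\<And>x. 0 \<le> k x" "(\<integral>\<^sup>+x. ennreal (k x) \<partial>\<mu>) < \<infinity>"
          using le_less_trans[OF k_le True] by (auto simp: k_def)
        have above_k: "sup_min_fun l f g z \<le> ennreal (k z)" for z
          using above sup_min_fun_le_1[OF assms(4) l, where g = g and z = z] by (simp add: k space)
        have "ennreal (1 / ((1 - l) / F + l / G))
            \<le> (\<integral>\<^sup>+p. ennreal (exp (- p) * exp_level_measure \<mu> k p) \<partial>lborel)"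
        proof (rule harmonic_Prekopa_Leindler_mono)
          show "exp_level_measure \<mu> f u powr (p * (1 - l) / u) * exp_level_measure \<mu> g v powr (p * l / v)
              \<le> exp_level_measure \<mu> k p"
            if "0 < u" "0 < v" "0 < exp_level_measure \<mu> f u" "0 < exp_level_measure \<mu> g v"
              "p = 1 / ((1 - l) / u + l / v)" for u v p
            by (rule exp_level_measure_log_concave[OF assms(1) f(1,3) g(1,3) k' above_k l that])
        qed (use assms(4,5) l FG in \<open>auto simp: exp_level_measure_nonneg exp_level_measure_negative
            mono_exp_level_measure[OF f(1,3)] mono_exp_level_measure[OF g(1,3)]
            mono_exp_level_measure[OF k'(1,3)]
            nn_integral_exp_level_measure[OF f] nn_integral_exp_level_measure[OF g] F G\<close>)
        also have "\<dots> \<le> integral\<^sup>N \<mu> H"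
          using k_le by (simp add: nn_integral_exp_level_measure[OF k'])
        finally show ?thesis .
      qed (simp add: not_less top_unique)
    qed
  qed
qed

end
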